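(* Let $d\ge1$ and $Z=\{z_1,\dots,z_N\}\subset\mathbb S^d$. Then $$4\,[D_{L^2,\mathrm{slice}}(Z)]^2=\frac1{N^2}\sum_{i,j=1}^N\big(1-d(z_i,z_j)\big)^2-\int_{\mathbb S^d}\int_{\mathbb S^d}\big(1-d(x,y)\big)^2\,d\sigma(x)\,d\sigma(y).$$
   Context: $\mathbb S^d\subset\mathbb R^{d+1}$ is the unit sphere, $\sigma$ is the normalized surface measure ($\sigma(\mathbb S^d)=1$), and $d(x,y)=\frac1\pi\arccos(x\cdot y)$ is the normalized geodesic distance. For $x,y\in\mathbb S^d$ the spherical slice is $S_{xy}=\{z\in\mathbb S^d:x\cdot z>0,\ y\cdot z<0\}$. The $L^2$ slice discrepancy is $$D_{L^2,\mathrm{slice}}(Z)=\left(\int_{\mathbb S^d}\int_{\mathbb S^d}\Big(\frac1N\sum_{i=1}^N\mathbf 1_{S_{xy}}(z_i)-\sigma(S_{xy})\Big)^2d\sigma(x)\,d\sigma(y)\right)^{1/2}.$$ *)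

theory Defs
  imports "HOL-Probability.Probability"
begin

text \<open>
  The unit sphere of a (d+1)-dimensional Euclidean space is \<open>sphere 0 1\<close> in a type
  of class \<open>euclidean_space\<close> with \<open>DIM('a) = d + 1\<close>.

  The surface measure of a Borel set \<open>A\<close> of the sphere is \<open>DIM('a)\<close> times the Lebesgue
  measure of the cone over \<open>A\<close> in the unit ball (integration in polar coordinates);
  normalizing the total mass to 1 cancels the factor \<open>DIM('a)\<close>.  Equivalently, the normalized
  surface measure is the law of the radial projection \<open>sgn x = x /\<^sub>R norm x\<close> of a uniformly
  distributed point of the unit ball, and that is how it is defined.  The lemmas below
  give the cone formula and check that it is the rotation invariant probability measure.
\<close>

definition sphere_measure :: "'a::euclidean_space measure" where
  "sphere_measure =
     restrict_space (distr (uniform_measure lborel (ball 0 1)) borel sgn) (sphere 0 1)"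

definition geodesic_dist :: "'a::euclidean_space \<Rightarrow> 'a \<Rightarrow> real" where
  "geodesic_dist x y = arccos (x \<bullet> y) / pi"

definition slice :: "'a::euclidean_space \<Rightarrow> 'a \<Rightarrow> 'a set" where
  "slice x y = {z \<in> sphere 0 1. x \<bullet> z > 0 \<and> y \<bullet> z < 0}"

text \<open>Point sets are given as families \<open>z\<^sub>1, \<dots>, z\<^sub>N\<close>; only the values \<open>z i\<close> with
  \<open>i \<in> {1..N}\<close> are used.\<close>

definition slice_discrepancy :: "nat \<Rightarrow> (nat \<Rightarrow> 'a::euclidean_space) \<Rightarrow> real" where
  "slice_discrepancy N z =
     sqrt (LINT y|sphere_measure. LINT x|sphere_measure.
       ((1 / real N) * (\<Sum>i=1..N. indicator (slice x y) (z i))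
          - measure sphere_measure (slice x y))\<^sup>2)"

lemma measurable_sgn_borel [measurable]:
  "(sgn :: 'a::euclidean_space \<Rightarrow> 'a) \<in> borel_measurable borel"
  unfolding sgn_div_norm by measurable

lemma space_sphere_measure [simp]: "space sphere_measure = sphere 0 1"
  by (simp add: sphere_measure_def space_restrict_space)

lemma sets_sphere_measure [measurable_cong]:
  "sets sphere_measure = sets (restrict_space borel (sphere 0 1))"
  unfolding sphere_measure_def by (rule sets_restrict_space_cong) simp

lemma emeasure_sphere_measure:
  fixes A :: "'a::euclidean_space set"
  assumes A: "A \<in> sets borel" "A \<subseteq> sphere 0 1"
  shows "emeasure sphere_measure A =
     emeasure lborel {x \<in> ball 0 1. sgn x \<in> A} / emeasure lborel (ball (0::'a) 1)"
proof -
  have [measurable]: "A \<in> sets borel" by fact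
  have "emeasure sphere_measure A =
      emeasure (uniform_measure lborel (ball 0 1)) (sgn -` A)"
    unfolding sphere_measure_def using A
    by (subst emeasure_restrict_space) (auto simp: emeasure_distr)
  also have "\<dots> = emeasure lborel (ball 0 1 \<inter> sgn -` A) / emeasure lborel (ball (0::'a) 1)"
    by (subst emeasure_uniform_measure)
       (auto intro: measurable_sets_borel[OF measurable_sgn_borel])
  also have "ball 0 1 \<inter> sgn -` A = {x \<in> ball 0 1. sgn x \<in> A}" by auto
  finally show ?thesis .
qed

lemma prob_space_sphere_measure: "prob_space (sphere_measure :: 'a::euclidean_space measure)"
proof
  have pos: "emeasure lborel (ball (0::'a) 1) \<noteq> 0" "emeasure lborel (ball (0::'a) 1) \<noteq> \<infinity>"
    using content_ball_pos[of 1 "0::'a"] emeasure_lborel_ball_finite[of "0::'a" 1]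
    by (auto simp: emeasure_eq_ennreal_measure)
  have "{x \<in> ball (0::'a) 1. sgn x \<in> sphere 0 1} = ball 0 1 - {0}"
    by (auto simp: norm_sgn)
  moreover have "emeasure lborel (ball 0 1 - {0::'a}) = emeasure lborel (ball (0::'a) 1)"
    by (simp add: emeasure_Diff)
  ultimately show "emeasure sphere_measure (space (sphere_measure :: 'a measure)) = 1"
    using pos by (simp add: emeasure_sphere_measure ennreal_divide_self less_top)
qed

text \<open>Uniqueness of Haar measure, for a map that preserves the unit ball.\<close>

lemma emeasure_lborel_orthogonal_vimage:
  fixes f :: "'a::euclidean_space \<Rightarrow> 'a"
  assumes f: "orthogonal_transformation f" and B: "B \<in> sets borel"
  shows "emeasure lborel (f -` B) = emeasure lborel B"
proof -
  have lin: "linear f" using f by (rule orthogonal_transformation_linear)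
  have [measurable]: "f \<in> borel_measurable borel"
    using lin by (intro borel_measurable_continuous_onI linear_continuous_on)
      (simp add: linear_linear)
  have [measurable]: "B \<in> sets borel" by fact
  define U where "U = ball (0::'a) 1"
  have [measurable]: "U \<in> sets borel" by (simp add: U_def)
  have U: "f y \<in> U \<longleftrightarrow> y \<in> U" "- y \<in> U \<longleftrightarrow> y \<in> U" for y
    using f by (auto simp: U_def orthogonal_transformation_norm)
  have pos: "emeasure lborel U \<noteq> 0" "emeasure lborel U \<noteq> \<infinity>"
    using content_ball_pos[of 1 "0::'a"] emeasure_lborel_ball_finite[of "0::'a" 1]
    by (auto simp: U_def emeasure_eq_ennreal_measure)
  have trans: "(\<integral>\<^sup>+x. g (t + x) \<partial>lborel) = (\<integral>\<^sup>+x. g x \<partial>lborel)"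
    if [measurable]: "g \<in> borel_measurable borel" for g :: "'a \<Rightarrow> ennreal" and t
    by (subst (2) lborel_distr_plus[of t, symmetric], subst nn_integral_distr) auto
  have surj: "\<exists>s. f s = t" for t
    using orthogonal_transformation_surj[OF f] by (metis surjD)
  have ftrans: "(\<integral>\<^sup>+y. indicator B (x + f y) \<partial>lborel) = emeasure lborel (f -` B)" for x
  proof -
    obtain s where s: "f s = x" using surj by blast
    have "(\<integral>\<^sup>+y. indicator B (x + f y) \<partial>lborel) = (\<integral>\<^sup>+y. indicator B (f (s + y)) \<partial>lborel)"
      by (simp add: linear_add[OF lin] s)
    also have "\<dots> = (\<integral>\<^sup>+y. indicator B (f y) \<partial>lborel)"
      by (rule trans[of "\<lambda>y. indicator B (f y)"]) measurable
    also have "\<dots> = (\<integral>\<^sup>+y. indicator (f -` B) y \<partial>lborel)"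
      by (simp add: indicator_def)
    also have "\<dots> = emeasure lborel (f -` B)"
      by (rule nn_integral_indicator) (use measurable_sets_borel[of f borel B] in simp)
    finally show ?thesis .
  qed
  have "emeasure lborel U * emeasure lborel (f -` B)
      = (\<integral>\<^sup>+x. indicator U x * (\<integral>\<^sup>+y. indicator B (x + f y) \<partial>lborel) \<partial>lborel)"
    by (simp add: ftrans nn_integral_multc mult.commute)
  also have "\<dots> = (\<integral>\<^sup>+x. \<integral>\<^sup>+y. indicator U x * indicator B (x + f y) \<partial>lborel \<partial>lborel)"
    by (simp add: nn_integral_cmult)
  also have "\<dots> = (\<integral>\<^sup>+y. \<integral>\<^sup>+x. indicator U x * indicator B (x + f y) \<partial>lborel \<partial>lborel)"
    by (rule lborel_pair.Fubini') measurable
  also have "\<dots> = (\<integral>\<^sup>+y. \<integral>\<^sup>+x. indicator U (x - f y) * indicator B x \<partial>lborel \<partial>lborel)"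
  proof (rule nn_integral_cong)
    fix y
    show "(\<integral>\<^sup>+x. indicator U x * indicator B (x + f y) \<partial>lborel)
        = (\<integral>\<^sup>+x. indicator U (x - f y) * indicator B x \<partial>lborel)"
      by (subst trans[of "\<lambda>x. indicator U (x - f y) * indicator B x" "f y", symmetric])
         (auto simp: add.commute)
  qed
  also have "\<dots> = (\<integral>\<^sup>+x. \<integral>\<^sup>+y. indicator U (x - f y) * indicator B x \<partial>lborel \<partial>lborel)"
    by (rule lborel_pair.Fubini') measurable
  also have "\<dots> = (\<integral>\<^sup>+x. emeasure lborel U * indicator B x \<partial>lborel)"
  proof (rule nn_integral_cong)
    fix x
    obtain s where s: "f s = - x" using surj by blast
    have "indicator U (x - f y) = (indicator U (s + y) :: ennreal)" for y
      using U(1)[of "s + y"] U(2)[of "x - f y"]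
      by (simp add: linear_add[OF lin] s indicator_def)
    then have "(\<integral>\<^sup>+y. indicator U (x - f y) * indicator B x \<partial>lborel)
        = (\<integral>\<^sup>+y. indicator U (s + y) \<partial>lborel) * indicator B x"
      by (simp add: nn_integral_multc)
    also have "(\<integral>\<^sup>+y. indicator U (s + y) \<partial>lborel) = emeasure lborel U"
      by (subst trans) auto
    finally show "(\<integral>\<^sup>+y. indicator U (x - f y) * indicator B x \<partial>lborel)
        = emeasure lborel U * indicator B x" .
  qed
  also have "\<dots> = emeasure lborel U * emeasure lborel B"
    by (simp add: nn_integral_cmult)
  finally show ?thesis
    using pos by (simp add: ennreal_mult_cancel_left)
qed

lemma emeasure_sphere_measure_orthogonal_vimage:
  fixes f :: "'a::euclidean_space \<Rightarrow> 'a"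
  assumes f: "orthogonal_transformation f" and A: "A \<in> sets borel" "A \<subseteq> sphere 0 1"
  shows "emeasure sphere_measure (f -` A) = emeasure sphere_measure A"
proof -
  have lin: "linear f" using f by (rule orthogonal_transformation_linear)
  have [measurable]: "f \<in> borel_measurable borel"
    using lin by (intro borel_measurable_continuous_onI linear_continuous_on)
      (simp add: linear_linear)
  have "f -` A \<in> sets borel" "f -` A \<subseteq> sphere 0 1"
    using A measurable_sets_borel[of f borel A] orthogonal_transformation_norm[OF f]
    by (auto simp: subset_iff)
  moreover have eq: "{x \<in> ball 0 1. sgn x \<in> f -` A} = f -` {x \<in> ball 0 1. sgn x \<in> A}"
    using f by (auto simp: orthogonal_transformation_norm sgn_div_norm linear_scale[OF lin])
  moreover have meas: "{x \<in> ball 0 1. sgn x \<in> A} \<in> sets borel"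
  proof -
    have "ball 0 1 \<inter> sgn -` A \<in> sets borel"
      using A measurable_sets_borel[OF measurable_sgn_borel, of A] by (intro sets.Int) auto
    also have "ball 0 1 \<inter> sgn -` A = {x \<in> ball 0 1. sgn x \<in> A}" by auto
    finally show ?thesis .
  qed
  ultimately show ?thesis
    using A emeasure_lborel_orthogonal_vimage[OF f meas]
    by (simp only: emeasure_sphere_measure eq)
qed

end

theory Submission
  imports Defs
begin

text \<open>
  A point \<open>w\<close> of the sphere lies in the slice of \<open>x\<close> and \<open>y\<close> iff \<open>x \<bullet> w > 0\<close> and \<open>y \<bullet> (-w) > 0\<close>,
  so the indicator factors into a function of \<open>x\<close> and a function of \<open>y\<close>.  Two open hemispheres with
  centres \<open>z\<close>, \<open>w\<close> overlap in measure \<open>(1 - d(z, w)) / 2\<close>: their difference is a lune, whose measure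
  is invariant under reflections and additive in the angle, hence linear in the angle.
  Expanding the square in the discrepancy and applying Fubini, the diagonal terms give
  \<open>(1 - d(z\<^sub>i, z\<^sub>j))\<^sup>2 / 4\<close>, while each cross term equals the integral of
  \<open>(1 - d(z\<^sub>i, w))\<^sup>2 / 4\<close> over \<open>w\<close>, which does not depend on \<open>z\<^sub>i\<close>; the integral of
  the squared slice measure has the same value.
\<close>

section \<open>Reflections and the invariance of the surface measure under them\<close>

definition reflection :: "'a::euclidean_space \<Rightarrow> 'a \<Rightarrow> 'a" where
  "reflection v x = x - (2 * (x \<bullet> v) / (v \<bullet> v)) *\<^sub>R v"

lemma linear_reflection: "linear (reflection v)"
  by (rule linearI) (simp_all add: reflection_def algebra_simps add_divide_distrib)

lemma inner_reflection: "reflection v x \<bullet> y = x \<bullet> reflection v y"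
  by (simp add: reflection_def inner_diff inner_commute mult.commute)

lemma reflection_reflection [simp]: "reflection v (reflection v x) = x"
  \<comment> \<open>Division by zero makes \<open>reflection 0\<close> the identity.\<close>
  by (cases "v = 0") (simp_all add: reflection_def inner_diff algebra_simps)

lemma orthogonal_transformation_reflection: "orthogonal_transformation (reflection v)"
  by (simp add: orthogonal_transformation_def linear_reflection inner_reflection)

lemma norm_reflection [simp]: "norm (reflection v x) = norm x"
  by (rule orthogonal_transformation_norm[OF orthogonal_transformation_reflection])

lemma reflection_fixes: "x \<bullet> v = 0 \<Longrightarrow> reflection v x = x"
  by (simp add: reflection_def)

text \<open>Equal norms give \<open>2 * (x \<bullet> (x - y)) = (x - y) \<bullet> (x - y)\<close>,
  so the coefficient of \<open>x - y\<close> in the reflection is 1.\<close>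

lemma reflection_swaps:
  assumes "norm x = norm y"
  shows "reflection (x - y) x = y"
proof (cases "x = y")
  case False
  have "x \<bullet> x = y \<bullet> y"
    using assms by (simp add: dot_square_norm)
  then have "2 * (x \<bullet> (x - y)) = (x - y) \<bullet> (x - y)"
    by (simp add: inner_diff inner_commute)
  with False show ?thesis
    by (simp add: reflection_def)
qed (simp add: reflection_def)

lemma measurable_sphere_measure_id:
  "(\<lambda>x. x) \<in> sphere_measure \<rightarrow>\<^sub>M (borel :: 'a::euclidean_space measure)"
  by (simp add: measurable_cong_sets[OF sets_sphere_measure refl] measurable_restrict_space1)

lemma measurable_reflection:
  "reflection v \<in> sphere_measure \<rightarrow>\<^sub>M (sphere_measure :: 'a::euclidean_space measure)"
proof -
  have "reflection v \<in> borel_measurable borel"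
    using linear_reflection[of v]
    by (intro borel_measurable_continuous_onI linear_continuous_on) (simp add: linear_linear)
  then have "reflection v \<in> restrict_space borel (sphere 0 1) \<rightarrow>\<^sub>M restrict_space borel (sphere 0 1)"
    by (intro measurable_restrict_space3) auto
  then show ?thesis
    by (simp add: measurable_cong_sets[OF sets_sphere_measure sets_sphere_measure])
qed

lemma distr_reflection:
  "distr sphere_measure sphere_measure (reflection v) = (sphere_measure :: 'a::euclidean_space measure)"
proof (rule measure_eqI)
  fix A assume "A \<in> sets (distr sphere_measure sphere_measure (reflection v))"
  then have A: "A \<in> sets sphere_measure" by simp
  then have A': "A \<in> sets borel" "A \<subseteq> sphere 0 1"
    by (auto simp: sets_sphere_measure sets_restrict_space)
  have "reflection v -` A \<inter> sphere 0 1 = reflection v -` A"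
    using A'(2) by (auto simp: subset_iff)
  with A show "emeasure (distr sphere_measure sphere_measure (reflection v)) A =
      emeasure sphere_measure A"
    by (simp add: emeasure_distr measurable_reflection
        emeasure_sphere_measure_orthogonal_vimage[OF orthogonal_transformation_reflection A'])
qed simp

lemma integral_reflection:
  fixes F :: "'a::euclidean_space \<Rightarrow> real"
  assumes "F \<in> borel_measurable sphere_measure"
  shows "(LINT x|sphere_measure. F (reflection v x)) = (LINT x|sphere_measure. F x)"
  using integral_distr[OF measurable_reflection assms, of v] by (simp add: distr_reflection)

text \<open>The cone over this great subsphere lies in a hyperplane, which is Lebesgue null.
  Boundaries of hemispheres can thus be ignored below.\<close>

lemma AE_sphere_measure_hyperplane:
  fixes u :: "'a::euclidean_space"
  assumes "u \<noteq> 0"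
  shows "AE x in sphere_measure. x \<bullet> u \<noteq> 0"
proof (rule AE_I)
  have [measurable]: "{x. x \<bullet> u = 0} \<in> sets borel"
    by measurable
  have "{x \<in> sphere 0 1. x \<bullet> u = 0} = sphere 0 1 \<inter> {x. x \<bullet> u = 0}"
    by auto
  then have A: "{x \<in> sphere 0 1. x \<bullet> u = 0} \<in> sets borel"
    by simp
  show N: "{x \<in> sphere 0 1. x \<bullet> u = 0} \<in> sets sphere_measure"
    using A by (auto simp: sets_sphere_measure sets_restrict_space)
  have "negligible {x. u \<bullet> x = 0}"
    using assms by (intro negligible_hyperplane) simp
  then have null: "emeasure lborel {x. x \<bullet> u = 0} = 0"
    by (simp add: negligible_iff_emeasure0 inner_commute)
  have "emeasure lborel {x \<in> ball 0 1. sgn x \<in> {x \<in> sphere 0 1. x \<bullet> u = 0}} \<le>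
      emeasure lborel {x. x \<bullet> u = 0}"
    by (rule emeasure_mono) (auto simp: sgn_div_norm)
  then have *: "emeasure lborel {x \<in> ball 0 1. sgn x \<in> {x \<in> sphere 0 1. x \<bullet> u = 0}} = 0"
    unfolding null by simp
  show "emeasure sphere_measure {x \<in> sphere 0 1. x \<bullet> u = 0} = 0"
    by (subst emeasure_sphere_measure[OF A], blast, subst *) simp
qed auto

section \<open>Hemispheres and lunes: the measure of a lune is linear in the angle\<close>

definition pos :: "'a::euclidean_space \<Rightarrow> 'a \<Rightarrow> real" where
  "pos x z = indicator {0<..} (x \<bullet> z)"

lemma pos_nonneg [simp]: "0 \<le> pos x z"
  by (simp add: pos_def)

lemma pos_le_1 [simp]: "pos x z \<le> 1"
  by (simp add: pos_def indicator_def)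

lemma pos_eq: "pos x z = (if x \<bullet> z > 0 then 1 else 0)"
  by (simp add: pos_def)

lemma pos_reflection: "pos (reflection v x) z = pos x (reflection v z)"
  by (simp add: pos_def inner_reflection)

text \<open>The forms with a negated argument serve the second factor \<open>pos y (- w)\<close> of
  a slice indicator.\<close>

lemma measurable_pos [measurable (raw)]:
  assumes "f \<in> M \<rightarrow>\<^sub>M sphere_measure"
  shows "(\<lambda>x. pos (f x) z) \<in> borel_measurable M"
    and "(\<lambda>x. pos z (f x)) \<in> borel_measurable M"
    and "(\<lambda>x. pos z (- f x)) \<in> borel_measurable M"
    and "g \<in> M \<rightarrow>\<^sub>M sphere_measure \<Longrightarrow> (\<lambda>x. pos (f x) (g x)) \<in> borel_measurable M"
    and "g \<in> M \<rightarrow>\<^sub>M sphere_measure \<Longrightarrow> (\<lambda>x. pos (f x) (- g x)) \<in> borel_measurable M"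
proof -
  note sphere_borel = measurable_compose[OF _ measurable_sphere_measure_id]
  have [measurable]: "f \<in> borel_measurable M"
    using assms by (rule sphere_borel)
  show "(\<lambda>x. pos (f x) z) \<in> borel_measurable M" "(\<lambda>x. pos z (f x)) \<in> borel_measurable M"
    "(\<lambda>x. pos z (- f x)) \<in> borel_measurable M"
    unfolding pos_def by measurable
  assume "g \<in> M \<rightarrow>\<^sub>M sphere_measure"
  then have [measurable]: "g \<in> borel_measurable M"
    by (rule sphere_borel)
  show "(\<lambda>x. pos (f x) (g x)) \<in> borel_measurable M" "(\<lambda>x. pos (f x) (- g x)) \<in> borel_measurable M"
    unfolding pos_def by measurable
qed

interpretation S: prob_space "sphere_measure :: 'a::euclidean_space measure"
  by (rule prob_space_sphere_measure)

lemma measure_sphere_measure_sphere [simp]: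
  "measure sphere_measure (sphere (0::'a::euclidean_space) 1) = 1"
  using S.prob_space[where 'a = 'a] by simp

text \<open>A difference of hemispheres is used instead of an intersection because it is additive
  along a great circle.\<close>

definition lune :: "'a::euclidean_space \<Rightarrow> 'a \<Rightarrow> real" where
  "lune z w = (LINT x|sphere_measure. pos x z * (1 - pos x w))"

lemma integrable_pos: "integrable sphere_measure (\<lambda>x. pos x z * pos x w)"
  "integrable sphere_measure (\<lambda>x. pos x z)"
  "integrable sphere_measure (\<lambda>x. pos x z * (1 - pos x w))"
  by (auto intro!: S.integrable_const_bound[where B = 1] AE_I2 simp: abs_mult mult_le_one)

text \<open>These crude bounds supply the boundedness that turns additivity in the angle into
  linearity.\<close>

lemma lune_bounds:
  fixes z w :: "'a::euclidean_space"
  shows "0 \<le> lune z w" "lune z w \<le> 1"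
proof -
  show "0 \<le> lune z w"
    unfolding lune_def by (intro Bochner_Integration.integral_nonneg) simp
  have "lune z w \<le> (LINT x|(sphere_measure :: 'a measure). 1)"
    unfolding lune_def by (intro integral_mono integrable_pos) (auto simp: pos_eq)
  then show "lune z w \<le> 1"
    by simp
qed

text \<open>Self-adjointness moves the reflection from \<open>z\<close> and \<open>w\<close> onto
  the integration variable, where the measure is invariant.\<close>

lemma lune_reflection: "lune (reflection v z) (reflection v w) = lune z w"
  using integral_reflection[of "\<lambda>x. pos x z * (1 - pos x w)" v]
  by (simp add: lune_def pos_reflection)

text \<open>One reflection moves \<open>z\<close> to \<open>z'\<close>; a second one, along a direction orthogonal to \<open>z'\<close>,
  then moves the image of \<open>w\<close> to \<open>w'\<close>.\<close>

lemma lune_cong_inner: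
  fixes z w z' w' :: "'a::euclidean_space"
  assumes "norm z = norm z'" "norm w = norm w'" "z \<bullet> w = z' \<bullet> w'"
  shows "lune z w = lune z' w'"
proof -
  define v where "v = reflection (z - z') w"
  have z: "reflection (z - z') z = z'"
    by (rule reflection_swaps) fact
  have "z' \<bullet> v = z \<bullet> w"
    using inner_reflection[of "z - z'" z v] by (simp add: v_def z)
  with assms(3) have "z' \<bullet> (v - w') = 0"
    by (simp add: inner_diff)
  then have "reflection (v - w') z' = z'"
    by (rule reflection_fixes)
  moreover have "reflection (v - w') v = w'"
    using assms(2) by (intro reflection_swaps) (simp add: v_def)
  ultimately have "lune z' w' = lune z' v"
    using lune_reflection[of "v - w'" z' v] by simp
  also have "\<dots> = lune z w"
    using lune_reflection[of "z - z'" z w] by (simp add: z v_def)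
  finally show ?thesis ..
qed

text \<open>The hemispheres around \<open>z\<close> and \<open>- z\<close> cover the sphere up to a
  null set. Each is the lune of its centre and the antipode, so \<open>lune_cong_inner\<close> shows
  that their measures agree.\<close>

lemma integral_pos:
  assumes "z \<noteq> (0::'a::euclidean_space)"
  shows "(LINT x|sphere_measure. pos x z) = 1 / 2"
proof -
  have 1: "lune z (-z) = (LINT x|sphere_measure. pos x z)"
    "lune (-z) z = (LINT x|sphere_measure. pos x (-z))"
    unfolding lune_def by (auto intro!: Bochner_Integration.integral_cong simp: pos_eq)
  have "(LINT x|sphere_measure. pos x z + pos x (-z)) = (LINT x|(sphere_measure :: 'a measure). 1)"
  proof (rule integral_cong_AE)
    show "AE x in sphere_measure. pos x z + pos x (-z) = 1"
      using AE_sphere_measure_hyperplane[OF assms] by eventually_elim (auto simp: pos_eq)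
  qed measurable
  moreover have "lune z (-z) = lune (-z) z"
    by (rule lune_cong_inner) auto
  ultimately show ?thesis
    using 1 by (simp add: integrable_pos)
qed

text \<open>The lunes of the four quarter turns from \<open>u\<close> through \<open>v\<close>,
  \<open>- u\<close> and \<open>- v\<close> back to \<open>u\<close> are congruent and tile the
  sphere up to a null set.\<close>

lemma lune_orthogonal:
  fixes u v :: "'a::euclidean_space"
  assumes u: "norm u = 1" and v: "norm v = 1" and uv: "u \<bullet> v = 0"
  shows "lune u v = 1 / 4"
proof -
  have *: "AE x in sphere_measure. x \<bullet> u \<noteq> 0" "AE x in sphere_measure. x \<bullet> v \<noteq> 0"
    using u v by (auto intro!: AE_sphere_measure_hyperplane)
  have "lune u v + lune v (-u) + lune (-u) (-v) + lune (-v) u =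
      (LINT x|sphere_measure. pos x u * (1 - pos x v) + pos x v * (1 - pos x (-u)) +
        pos x (-u) * (1 - pos x (-v)) + pos x (-v) * (1 - pos x u))"
    by (simp add: lune_def integrable_pos)
  also have "\<dots> = (LINT x|(sphere_measure :: 'a measure). 1)"
  proof (rule integral_cong_AE)
    show "AE x in sphere_measure. pos x u * (1 - pos x v) + pos x v * (1 - pos x (-u)) +
        pos x (-u) * (1 - pos x (-v)) + pos x (-v) * (1 - pos x u) = 1"
      using * by eventually_elim (auto simp: pos_eq)
  qed measurable
  finally have "lune u v + lune v (-u) + lune (-u) (-v) + lune (-v) u = 1"
    by (simp only: lebesgue_integral_const measure_sphere_measure_sphere space_sphere_measure scaleR_one)
  moreover have "lune v (-u) = lune u v" "lune (-u) (-v) = lune u v" "lune (-v) u = lune u v"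
    using assms by (auto intro!: lune_cong_inner simp: inner_commute)
  ultimately show ?thesis
    by linarith
qed

text \<open>The defect \<open>h t = g t - g c * t / c\<close> is \<open>c\<close>-periodic and satisfies \<open>h (2 * t) = 2 * h t\<close>,
  so any bound on it can be halved.\<close>

lemma additive_bounded_imp_linear:
  fixes g :: "real \<Rightarrow> real"
  assumes c: "c > 0"
    and add: "\<And>s t. 0 \<le> s \<Longrightarrow> 0 \<le> t \<Longrightarrow> s + t < 2 * c \<Longrightarrow> g (s + t) = g s + g t"
    and bound: "\<And>t. 0 \<le> t \<Longrightarrow> t < 2 * c \<Longrightarrow> \<bar>g t\<bar> \<le> B"
    and t: "0 \<le> t" "t < 2 * c"
  shows "g t = g c * t / c"
proof -
  define h where "h t = g t - g c * t / c" for t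
  have hadd: "h (s + t) = h s + h t" if "0 \<le> s" "0 \<le> t" "s + t < 2 * c" for s t
    using add[OF that] by (simp add: h_def algebra_simps add_divide_distrib)
  have hc: "h c = 0"
    using c by (simp add: h_def)
  \<comment> \<open>The constant is the bound for \<open>n = 0\<close>: \<open>B\<close> bounds
    \<open>g\<close>, and \<open>t / c < 2\<close> bounds the linear term.\<close>
  have halved: "\<bar>h t\<bar> \<le> (B + 2 * \<bar>g c\<bar>) / 2 ^ n" if "0 \<le> t" "t < 2 * c" for n t
    using that
  proof (induction n arbitrary: t)
    case 0
    have "\<bar>g c * t / c\<bar> = \<bar>g c\<bar> * (t / c)"
      using 0 c by (simp add: abs_mult)
    also have "\<dots> \<le> \<bar>g c\<bar> * 2"
      using 0 c by (intro mult_left_mono) (auto simp: divide_simps)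
    finally show ?case
      using bound[OF 0] by (simp add: h_def del: abs_divide)
  next
    case (Suc n)
    \<comment> \<open>Doubling applies only below \<open>c\<close>, since \<open>2 * s\<close> must
      stay in the domain; a larger argument is first shifted by \<open>c\<close>.\<close>
    have small: "\<bar>h s\<bar> \<le> (B + 2 * \<bar>g c\<bar>) / 2 ^ Suc n" if "0 \<le> s" "s < c" for s
      using Suc.IH[of "2 * s"] hadd[of s s] that
      by (simp add: field_simps abs_mult)
    show ?case
    proof (cases "t < c")
      case False
      then show ?thesis
        using small[of "t - c"] hadd[of c "t - c"] hc Suc.prems c by simp
    qed (use small Suc.prems in simp)
  qed
  have "(\<lambda>n. (B + 2 * \<bar>g c\<bar>) / 2 ^ n) \<longlonglongrightarrow> 0"
    by (rule LIMSEQ_divide_realpow_zero) simp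
  then have "\<bar>h t\<bar> \<le> 0"
    by (rule LIMSEQ_le_const) (use halved t in auto)
  then show ?thesis
    by (simp add: h_def)
qed

text \<open>The vector \<open>u s\<close> is a combination of \<open>u 0\<close> and
  \<open>u (s + t)\<close> with positive coefficients. So if \<open>x\<close> has positive inner
  product with both ends, it has one with \<open>u s\<close> too, and likewise for
  nonpositive.\<close>

lemma lune_add:
  fixes e1 e2 :: "'a::euclidean_space"
  assumes st: "0 < s" "0 < t" "s + t < pi"
  defines "u \<equiv> \<lambda>t. cos t *\<^sub>R e1 + sin t *\<^sub>R e2"
  shows "lune (u 0) (u (s + t)) = lune (u 0) (u s) + lune (u s) (u (s + t))"
proof -
  have sin: "sin s > 0" "sin t > 0" "sin (s + t) > 0"
    using st by (auto intro!: sin_gt_zero)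
  \<comment> \<open>This is the \<open>e1\<close> component of the combination; the
    \<open>e2\<close> component is commutativity.\<close>
  have "sin (s + t) * cos s = sin t + sin s * cos (s + t)"
  proof -
    have "sin t = sin ((s + t) - s)"
      by simp
    then show ?thesis
      unfolding sin_diff by simp
  qed
  then have "sin (s + t) *\<^sub>R u s = sin t *\<^sub>R u 0 + sin s *\<^sub>R u (s + t)"
    by (simp add: u_def algebra_simps flip: scaleR_add_left)
  then have "x \<bullet> (sin (s + t) *\<^sub>R u s) = x \<bullet> (sin t *\<^sub>R u 0 + sin s *\<^sub>R u (s + t))" for x
    by (rule arg_cong)
  then have comb: "sin (s + t) * (x \<bullet> u s) = sin t * (x \<bullet> u 0) + sin s * (x \<bullet> u (s + t))" for x
    by (simp add: inner_add)
  \<comment> \<open>Among the eight sign patterns the identity fails only in the two where the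
    middle disagrees with both ends.\<close>
  have "pos x (u 0) * (1 - pos x (u (s + t))) =
      pos x (u 0) * (1 - pos x (u s)) + pos x (u s) * (1 - pos x (u (s + t)))" for x
  proof -
    have "\<not> (x \<bullet> u 0 > 0 \<and> x \<bullet> u (s + t) > 0 \<and> x \<bullet> u s \<le> 0)"
    proof safe
      assume *: "x \<bullet> u 0 > 0" "x \<bullet> u (s + t) > 0" "x \<bullet> u s \<le> 0"
      have "sin t * (x \<bullet> u 0) + sin s * (x \<bullet> u (s + t)) > 0"
        using * sin by (intro add_pos_pos mult_pos_pos)
      moreover have "sin (s + t) * (x \<bullet> u s) \<le> 0"
        using * sin by (simp add: mult_nonneg_nonpos)
      ultimately show False
        using comb[of x] by simp
    qed
    moreover have "\<not> (x \<bullet> u 0 \<le> 0 \<and> x \<bullet> u (s + t) \<le> 0 \<and> x \<bullet> u s > 0)"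
    proof safe
      assume *: "x \<bullet> u 0 \<le> 0" "x \<bullet> u (s + t) \<le> 0" "x \<bullet> u s > 0"
      have "sin t * (x \<bullet> u 0) + sin s * (x \<bullet> u (s + t)) \<le> 0"
        using * sin by (intro add_nonpos_nonpos mult_nonneg_nonpos) auto
      moreover have "sin (s + t) * (x \<bullet> u s) > 0"
        using * sin by simp
      ultimately show False
        using comb[of x] by simp
    qed
    ultimately show ?thesis
      by (auto simp: pos_eq)
  qed
  then show ?thesis
    by (simp add: lune_def integrable_pos)
qed

text \<open>Away from \<open>w = z\<close> and \<open>w = - z\<close>, let \<open>u t\<close> run along the great circle through \<open>z\<close> and \<open>w\<close>;
  then \<open>lune z (u t)\<close> is additive in \<open>t\<close>, and its value at \<open>pi / 2\<close> is known.\<close>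

lemma lune_eq_arccos:
  fixes z w :: "'a::euclidean_space"
  assumes z: "norm z = 1" and w: "norm w = 1"
  shows "lune z w = arccos (z \<bullet> w) / (2 * pi)"
proof -
  have le1: "\<bar>z \<bullet> w\<bar> \<le> 1"
    using Cauchy_Schwarz_ineq2[of z w] z w by simp
  \<comment> \<open>In the first two cases the lune is empty or a hemisphere, and
    \<open>sin \<theta>\<close> would vanish as a divisor.\<close>
  consider "z \<bullet> w = 1" | "z \<bullet> w = -1" | "\<bar>z \<bullet> w\<bar> < 1"
    using le1 by linarith
  then show ?thesis
  proof cases
    case 1
    then have "w = z"
      using z w norm_cauchy_schwarz_eq[of z w] by simp
    then have "lune z w = (LINT x|(sphere_measure :: 'a measure). 0)"
      unfolding lune_def by (intro Bochner_Integration.integral_cong) (auto simp: pos_eq)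
    with 1 show ?thesis
      by simp
  next
    case 2
    then have "- w = z"
      using z w norm_cauchy_schwarz_eq[of z "-w"] by simp
    then have "w = - z"
      by auto
    then have "lune z w = (LINT x|sphere_measure. pos x z)"
      unfolding lune_def by (intro Bochner_Integration.integral_cong) (auto simp: pos_eq)
    also have "\<dots> = 1 / 2"
      using z by (intro integral_pos) auto
    finally show ?thesis
      using 2 by simp
  next
    case 3
    define \<theta> where "\<theta> = arccos (z \<bullet> w)"
    have \<theta>: "0 < \<theta>" "\<theta> < pi" and cos: "cos \<theta> = z \<bullet> w"
      using arccos_lt_bounded[of "z \<bullet> w"] 3 by (simp_all add: \<theta>_def abs_less_iff)
    then have sin: "sin \<theta> > 0"
      by (intro sin_gt_zero)
    \<comment> \<open>Gram-Schmidt: \<open>sin \<theta>\<close> is the norm of the component of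
      \<open>w\<close> orthogonal to \<open>z\<close>.\<close>
    define e where "e = (w - cos \<theta> *\<^sub>R z) /\<^sub>R sin \<theta>"
    have zz: "z \<bullet> z = 1" and ww: "w \<bullet> w = 1"
      using z w by (auto simp: dot_square_norm)
    have ze: "z \<bullet> e = 0"
      by (simp add: e_def inner_diff zz cos)
    have "(w - cos \<theta> *\<^sub>R z) \<bullet> (w - cos \<theta> *\<^sub>R z) = 1 - (cos \<theta>)\<^sup>2"
      by (simp add: inner_diff zz ww cos[symmetric] inner_commute[of w z] power2_eq_square)
    also have "\<dots> = (sin \<theta>)\<^sup>2"
      by (simp add: sin_squared_eq)
    finally have ee: "e \<bullet> e = 1"
      using sin by (simp add: e_def power2_eq_square flip: divide_inverse mult.assoc)
    define u where "u t = cos t *\<^sub>R z + sin t *\<^sub>R e" for t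
    have u: "u s \<bullet> u t = cos (t - s)" for s t
      by (simp add: u_def inner_add zz ee ze inner_commute[of e z] cos_diff)
    have norm_u: "norm (u t) = 1" for t
      using u[of t t] by (simp add: norm_eq_1)
    have u0: "u 0 = z" and u\<theta>: "u \<theta> = w"
      using sin by (auto simp: u_def e_def)
    define g where "g t = lune (u 0) (u t)" for t
    \<comment> \<open>With \<open>c = pi / 2\<close> the domain \<open>0 \<le> t < 2 * c\<close>
      covers all angles below \<open>pi\<close>, and the value at \<open>c\<close> is that of the
      orthogonal lune.\<close>
    have "g \<theta> = g (pi / 2) * \<theta> / (pi / 2)"
    proof (rule additive_bounded_imp_linear)
      fix s t :: real
      assume st: "0 \<le> s" "0 \<le> t" "s + t < 2 * (pi / 2)"
      \<comment> \<open>Rotation invariance along the circle: both pairs of unit vectors enclose the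
        angle \<open>t\<close>.\<close>
      have "lune (u s) (u (s + t)) = g t"
        unfolding g_def by (rule lune_cong_inner) (simp_all add: u norm_u)
      moreover have "lune (u 0) (u 0) = 0"
        by (simp add: lune_def pos_eq cong: if_cong)
          (subst Bochner_Integration.integral_cong[where g = "\<lambda>_. 0"], auto)
      ultimately show "g (s + t) = g s + g t"
        using lune_add[of s t z e] st
        by (cases "s = 0 \<or> t = 0") (auto simp: g_def u_def)
    qed (use \<theta> lune_bounds[where 'a = 'a] in \<open>auto simp: g_def\<close>)
    moreover have "g (pi / 2) = 1 / 4"
      unfolding g_def by (rule lune_orthogonal) (simp_all add: u norm_u)
    ultimately have "g \<theta> = \<theta> / (2 * pi)"
      by simp
    then show ?thesis
      by (simp add: g_def u0 u\<theta>) (simp add: \<theta>_def)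
  qed
qed

section \<open>Overlaps of two hemispheres\<close>

definition overlap :: "'a::euclidean_space \<Rightarrow> 'a \<Rightarrow> real" where
  "overlap z w = (LINT x|sphere_measure. pos x z * pos x w)"

text \<open>The hemisphere around \<open>z\<close>, of measure 1/2, splits into the overlap and the
  lune.\<close>

lemma overlap_eq_geodesic_dist:
  fixes z w :: "'a::euclidean_space"
  assumes "norm z = 1" "norm w = 1"
  shows "overlap z w = (1 - geodesic_dist z w) / 2"
proof -
  have "overlap z w + lune z w = (LINT x|sphere_measure. pos x z)"
    by (simp add: overlap_def lune_def integrable_pos right_diff_distrib)
  also have "\<dots> = 1 / 2"
    using assms by (intro integral_pos) auto
  finally show ?thesis
    by (simp add: lune_eq_arccos[OF assms] geodesic_dist_def diff_divide_distrib mult.commute)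
qed

lemma overlap_uminus:
  assumes "norm z = 1" "norm w = 1"
  shows "overlap (-z) (-w) = overlap z w"
  using assms by (simp add: overlap_eq_geodesic_dist geodesic_dist_def)

lemma measurable_overlap [measurable]: "overlap z \<in> borel_measurable sphere_measure"
  unfolding overlap_def by measurable

text \<open>Substitute the reflection that takes \<open>z\<close> to \<open>z'\<close>; the overlap
  of unit vectors depends only on their inner product.\<close>

lemma integral_overlap_power2_const:
  fixes z z' :: "'a::euclidean_space"
  assumes "norm z = 1" "norm z' = 1"
  shows "(LINT w|sphere_measure. (overlap z w)\<^sup>2) = (LINT w|sphere_measure. (overlap z' w)\<^sup>2)"
proof -
  define v where "v = z - z'"
  have v: "reflection v z = z'"
    unfolding v_def using assms by (intro reflection_swaps) simp
  have "(LINT w|sphere_measure. (overlap z' w)\<^sup>2) =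
      (LINT w|sphere_measure. (overlap z' (reflection v w))\<^sup>2)"
    by (rule integral_reflection[symmetric]) measurable
  also have "\<dots> = (LINT w|sphere_measure. (overlap z w)\<^sup>2)"
  proof (rule Bochner_Integration.integral_cong)
    fix w :: 'a assume "w \<in> space sphere_measure"
    then show "(overlap z' (reflection v w))\<^sup>2 = (overlap z w)\<^sup>2"
      using assms inner_reflection[of v z "reflection v w"]
      by (simp add: overlap_eq_geodesic_dist geodesic_dist_def v)
  qed simp
  finally show ?thesis ..
qed

section \<open>Fubini for bounded functions on the sphere\<close>

interpretation SS: pair_prob_space "sphere_measure :: 'a::euclidean_space measure" "sphere_measure :: 'a measure"
  by unfold_locales

lemma abs_integral_le:
  fixes f :: "'a::euclidean_space \<Rightarrow> real"
  assumes B: "\<And>x. \<bar>f x\<bar> \<le> B"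
  shows "\<bar>LINT x|sphere_measure. f x\<bar> \<le> B"
proof (cases "integrable sphere_measure f")
  case True
  have "\<bar>LINT x|sphere_measure. f x\<bar> \<le> (LINT x|sphere_measure. \<bar>f x\<bar>)"
    by (rule integral_abs_bound)
  also have "\<dots> \<le> (LINT x|(sphere_measure :: 'a measure). B)"
    using True B by (intro integral_mono) auto
  finally show ?thesis
    by simp
next
  \<comment> \<open>A non-integrable function has integral 0 by default, and \<open>B\<close> is
    nonnegative because it bounds an absolute value.\<close>
  case False
  then show ?thesis
    using order_trans[OF abs_ge_zero B] by (simp add: not_integrable_integral_eq)
qed

lemma integrable_pair_bounded:
  fixes F :: "'a::euclidean_space \<Rightarrow> 'a \<Rightarrow> real"
  assumes "(\<lambda>(x, y). F x y) \<in> borel_measurable (sphere_measure \<Otimes>\<^sub>M sphere_measure)"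
    and "\<And>x y. \<bar>F x y\<bar> \<le> B"
  shows "integrable (sphere_measure \<Otimes>\<^sub>M sphere_measure) (\<lambda>(x, y). F x y)"
  using assms by (intro SS.P.integrable_const_bound[where B = B]) auto

text \<open>It brings the integral hidden in \<open>slice_area\<close> to the outside: first
  \<open>w\<close> is exchanged with \<open>x\<close> for fixed \<open>y\<close>, then with
  \<open>y\<close>.\<close>

lemma integral_rotate:
  fixes G :: "'a::euclidean_space \<Rightarrow> 'a \<Rightarrow> 'a \<Rightarrow> real"
  assumes G: "(\<lambda>(x, y, w). G x y w) \<in>
      borel_measurable (sphere_measure \<Otimes>\<^sub>M sphere_measure \<Otimes>\<^sub>M sphere_measure)"
    and B: "\<And>x y w. \<bar>G x y w\<bar> \<le> B"
  shows "(LINT y|sphere_measure. LINT x|sphere_measure. LINT w|sphere_measure. G x y w) =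
    (LINT w|sphere_measure. LINT y|sphere_measure. LINT x|sphere_measure. G x y w)"
proof -
  have G' [measurable (raw)]: "(\<lambda>p. G (f p) (g p) (h p)) \<in> borel_measurable M"
    if "f \<in> M \<rightarrow>\<^sub>M sphere_measure" "g \<in> M \<rightarrow>\<^sub>M sphere_measure" "h \<in> M \<rightarrow>\<^sub>M sphere_measure"
    for f g h and M :: "'b measure"
    using measurable_compose[OF measurable_Pair[OF that(1) measurable_Pair[OF that(2,3)]] G] by simp
  have "(LINT y|sphere_measure. LINT x|sphere_measure. LINT w|sphere_measure. G x y w) =
      (LINT y|sphere_measure. LINT w|sphere_measure. LINT x|sphere_measure. G x y w)"
  proof (rule Bochner_Integration.integral_cong)
    fix y :: 'a assume y: "y \<in> space sphere_measure"
    have "(\<lambda>(x, w). G x y w) \<in> borel_measurable (sphere_measure \<Otimes>\<^sub>M sphere_measure)"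
      unfolding split_beta' by (intro G' measurable_const[OF y] measurable_fst measurable_snd)
    then show "(LINT x|sphere_measure. LINT w|sphere_measure. G x y w) =
        (LINT w|sphere_measure. LINT x|sphere_measure. G x y w)"
      using B by (intro SS.Fubini_integral[symmetric] integrable_pair_bounded)
  qed simp
  also have "\<dots> = (LINT w|sphere_measure. LINT y|sphere_measure. LINT x|sphere_measure. G x y w)"
  proof (intro SS.Fubini_integral[symmetric] integrable_pair_bounded)
    \<comment> \<open>The triple is regrouped as \<open>((y, w), x)\<close> so that integrating out
      the last component leaves a measurable function of \<open>(y, w)\<close>.\<close>
    have "(\<lambda>p. G (snd p) (fst (fst p)) (snd (fst p))) \<in>
        borel_measurable ((sphere_measure \<Otimes>\<^sub>M sphere_measure) \<Otimes>\<^sub>M sphere_measure)"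
      by (rule G') measurable
    then show "(\<lambda>(y, w). LINT x|sphere_measure. G x y w) \<in>
        borel_measurable (sphere_measure \<Otimes>\<^sub>M sphere_measure)"
      unfolding split_beta' by (intro S.borel_measurable_lebesgue_integral) (simp add: split_beta')
  qed (rule abs_integral_le, rule B)
  finally show ?thesis .
qed

section \<open>The integrals in the expanded square\<close>

definition slice_area :: "'a::euclidean_space \<Rightarrow> 'a \<Rightarrow> real" where
  "slice_area x y = (LINT w|sphere_measure. pos x w * pos y (-w))"

lemma indicator_slice:
  "z \<in> sphere 0 1 \<Longrightarrow> (indicator (slice x y) z :: real) = pos x z * pos y (-z)"
  by (simp add: slice_def pos_eq)

text \<open>As an integral of a product of hemisphere indicators, the measure becomes accessible to
  Fubini.\<close>

lemma measure_slice: "measure sphere_measure (slice x y) = slice_area x y"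
proof -
  have "{z. x \<bullet> z > 0 \<and> y \<bullet> z < 0} \<in> sets borel"
    by measurable
  then have "sphere 0 1 \<inter> {z. x \<bullet> z > 0 \<and> y \<bullet> z < 0} \<in> sets sphere_measure"
    by (auto simp: sets_sphere_measure sets_restrict_space)
  also have "sphere 0 1 \<inter> {z. x \<bullet> z > 0 \<and> y \<bullet> z < 0} = slice x y"
    by (auto simp: slice_def)
  finally have meas: "slice x y \<in> sets sphere_measure" .
  have "slice_area x y = (LINT w|sphere_measure. indicator (slice x y) w)"
    unfolding slice_area_def
    by (intro Bochner_Integration.integral_cong) (simp_all add: indicator_slice)
  also have "slice x y \<inter> sphere 0 1 = slice x y"
    by (auto simp: slice_def)
  then have "(LINT w|sphere_measure. indicator (slice x y) w) = measure sphere_measure (slice x y)"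
    using meas by simp
  finally show ?thesis ..
qed

lemma abs_pos_mult_le: "\<bar>a\<bar> \<le> 1 \<Longrightarrow> \<bar>pos x z * a\<bar> \<le> 1"
  by (simp add: pos_eq)

lemma abs_slice_area_le: "\<bar>slice_area x y\<bar> \<le> 1"
  unfolding slice_area_def by (intro abs_integral_le abs_pos_mult_le) simp

lemma measurable_slice_area [measurable (raw)]:
  assumes [measurable]: "f \<in> M \<rightarrow>\<^sub>M sphere_measure" "g \<in> M \<rightarrow>\<^sub>M sphere_measure"
  shows "(\<lambda>p. slice_area (f p) (g p)) \<in> borel_measurable M"
  unfolding slice_area_def by measurable

text \<open>The integrand separates: the \<open>x\<close> factor integrates to the overlap of
  \<open>z\<close> and \<open>w\<close>, the \<open>y\<close> factor to that of their antipodes,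
  which is equal.\<close>

lemma integral_slice_pair:
  fixes z w :: "'a::euclidean_space"
  assumes "norm z = 1" "norm w = 1"
  shows "(LINT y|sphere_measure. LINT x|sphere_measure.
      (pos x z * pos y (-z)) * (pos x w * pos y (-w))) = (overlap z w)\<^sup>2"
proof -
  have "(LINT x|sphere_measure. (pos x z * pos y (-z)) * (pos x w * pos y (-w))) =
      overlap z w * (pos y (-z) * pos y (-w))" for y
    unfolding overlap_def Bochner_Integration.integral_mult_left_zero[symmetric]
    by (simp add: mult_ac)
  then show ?thesis
    using overlap_uminus[OF assms] by (simp add: overlap_def power2_eq_square)
qed

lemma integral_slice_area_cross:
  fixes z :: "'a::euclidean_space"
  assumes z: "norm z = 1"
  shows "(LINT y|sphere_measure. LINT x|sphere_measure. (pos x z * pos y (-z)) * slice_area x y) =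
    (LINT w|sphere_measure. (overlap z w)\<^sup>2)"
proof -
  have "(LINT y|sphere_measure. LINT x|sphere_measure. (pos x z * pos y (-z)) * slice_area x y) =
      (LINT y|sphere_measure. LINT x|sphere_measure. LINT w|sphere_measure.
        (pos x z * pos y (-z)) * (pos x w * pos y (-w)))"
    by (simp add: slice_area_def)
  also have "\<dots> = (LINT w|sphere_measure. LINT y|sphere_measure. LINT x|sphere_measure.
        (pos x z * pos y (-z)) * (pos x w * pos y (-w)))"
  proof (rule integral_rotate[where B = 1])
    show "\<bar>(pos x z * pos y (-z)) * (pos x w * pos y (-w))\<bar> \<le> 1" for x y w
      by (simp add: pos_eq)
  qed measurable
  also have "\<dots> = (LINT w|sphere_measure. (overlap z w)\<^sup>2)"
    by (intro Bochner_Integration.integral_cong integral_slice_pair z) auto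
  finally show ?thesis .
qed

text \<open>One factor of the square is written as an integral over \<open>v\<close> and moved
  outside. For each \<open>v\<close> a cross term remains, whose value does not depend on
  \<open>v\<close>, and the total mass is 1.\<close>

lemma integral_slice_area_power2:
  fixes z :: "'a::euclidean_space"
  assumes z: "norm z = 1"
  shows "(LINT y|sphere_measure. LINT x|sphere_measure. (slice_area x (y :: 'a))\<^sup>2) =
    (LINT w|sphere_measure. (overlap z w)\<^sup>2)"
proof -
  have "(LINT y|sphere_measure. LINT x|sphere_measure. (slice_area x (y :: 'a))\<^sup>2) =
      (LINT y|sphere_measure. LINT x|sphere_measure. LINT v|sphere_measure.
        (pos x v * pos y (-v)) * slice_area x (y :: 'a))"
    by (simp add: power2_eq_square flip: slice_area_def)
  also have "\<dots> = (LINT v|sphere_measure. LINT y|sphere_measure. LINT x|sphere_measure.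
        (pos x v * pos y (-v)) * slice_area x (y :: 'a))"
  proof (rule integral_rotate[where B = 1])
    show "\<bar>(pos x v * pos y (-v)) * slice_area x y\<bar> \<le> 1" for x y v
      using abs_slice_area_le[of x y] by (simp add: pos_eq)
  qed measurable
  also have "\<dots> = (LINT v|(sphere_measure :: 'a measure). LINT w|sphere_measure. (overlap z w)\<^sup>2)"
  proof (rule Bochner_Integration.integral_cong)
    fix v :: 'a assume "v \<in> space sphere_measure"
    then have v: "norm v = 1" by simp
    show "(LINT y|sphere_measure. LINT x|sphere_measure. (pos x v * pos y (-v)) * slice_area x y) =
        (LINT w|sphere_measure. (overlap z w)\<^sup>2)"
      using integral_slice_area_cross[OF v] integral_overlap_power2_const[OF v z] by simp
  qed simp
  finally show ?thesis
    by simp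
qed

section \<open>Assembly of the identity\<close>

theorem theorem6p4:
  fixes d N :: nat and z :: "nat \<Rightarrow> 'a::euclidean_space"
  assumes "DIM('a) = d + 1" and "d \<ge> 1"
    and "N \<ge> 1" and "\<And>i. i \<in> {1..N} \<Longrightarrow> z i \<in> sphere 0 1"
  shows "4 * (slice_discrepancy N z)\<^sup>2 =
    (1 / (real N)\<^sup>2) * (\<Sum>i=1..N. \<Sum>j=1..N. (1 - geodesic_dist (z i) (z j))\<^sup>2)
    - (LINT y|(sphere_measure :: 'a measure). LINT x|(sphere_measure :: 'a measure).
         (1 - geodesic_dist x y)\<^sup>2)"
proof -
  have z: "norm (z i) = 1" if "i \<in> {1..N}" for i
    using assms(4)[OF that] by simp
  \<comment> \<open>By invariance any unit vector gives the same value, and \<open>z 1\<close>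
    serves as representative; \<open>4 * C\<close> is the double integral of the claim.\<close>
  define C where "C = (LINT w|sphere_measure. (overlap (z 1) w)\<^sup>2)"
  have C: "(LINT w|sphere_measure. (overlap v w)\<^sup>2) = C" if "norm v = 1" for v :: 'a
    unfolding C_def using assms(3) by (intro integral_overlap_power2_const that z) auto
  define p where "p i x y = pos x (z i) * pos y (- z i)" for i x y
  let ?S = "sphere_measure :: 'a measure"
  note split_beta' [simp]
  have pp: "integrable (?S \<Otimes>\<^sub>M ?S) (\<lambda>(x, y). p i x y * p j x y)" for i j
    unfolding p_def by (intro integrable_pair_bounded[where B = 1]) (simp, simp add: pos_eq)
  have pa: "integrable (?S \<Otimes>\<^sub>M ?S) (\<lambda>(x, y). p i x y * slice_area x y)" for i
    unfolding p_def
    by (intro integrable_pair_bounded[where B = 1]) (simp, simp add: pos_eq abs_slice_area_le)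
  have aa: "integrable (?S \<Otimes>\<^sub>M ?S) (\<lambda>(x, y). (slice_area x y)\<^sup>2)"
    by (intro integrable_pair_bounded[where B = 1]) (simp, simp add: abs_square_le_1 abs_slice_area_le)
  have Epp: "(\<integral>q. p i (fst q) (snd q) * p j (fst q) (snd q) \<partial>(?S \<Otimes>\<^sub>M ?S)) = (overlap (z i) (z j))\<^sup>2"
    if "i \<in> {1..N}" "j \<in> {1..N}" for i j
    using SS.integral_snd[OF pp] integral_slice_pair[OF z z, OF that] by (simp add: p_def)
  have Epa: "(\<integral>q. p i (fst q) (snd q) * slice_area (fst q) (snd q) \<partial>(?S \<Otimes>\<^sub>M ?S)) = C"
    if "i \<in> {1..N}" for i
    using SS.integral_snd[OF pa] integral_slice_area_cross[OF z, OF that] C[OF z, OF that]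
    by (simp add: p_def)
  have Eaa: "(\<integral>q. (slice_area (fst q) (snd q))\<^sup>2 \<partial>(?S \<Otimes>\<^sub>M ?S)) = C"
    using SS.integral_snd[OF aa] integral_slice_area_power2[of "z 1"] z[of 1] C[of "z 1"] assms(3)
    by simp
  define T where "T x y = (1 / (real N)\<^sup>2) * (\<Sum>i=1..N. \<Sum>j=1..N. p i x y * p j x y)
      - (2 / real N) * (\<Sum>i=1..N. p i x y * slice_area x y) + (slice_area x y)\<^sup>2" for x y
  have T: "((1 / real N) * (\<Sum>i=1..N. indicator (slice x y) (z i))
      - measure sphere_measure (slice x y))\<^sup>2 = T x y" for x y
  proof -
    have "(\<Sum>i=1..N. indicator (slice x y) (z i)) = (\<Sum>i=1..N. p i x y)"
      unfolding p_def by (intro sum.cong refl indicator_slice assms(4))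
    then show ?thesis
      unfolding measure_slice T_def sum_product[symmetric] sum_distrib_right[symmetric]
      by (simp add: power2_eq_square algebra_simps)
  qed
  have intT: "integrable (?S \<Otimes>\<^sub>M ?S) (\<lambda>(x, y). T x y)"
    using pp pa aa by (simp add: T_def)
  have "(slice_discrepancy N z)\<^sup>2 = (LINT y|sphere_measure. LINT x|sphere_measure. T x y)"
    \<comment> \<open>The square root is cancelled while \<open>T\<close> is still a visible square,
      which makes the integral nonnegative.\<close>
    unfolding slice_discrepancy_def T[symmetric]
    by (intro real_sqrt_pow2 Bochner_Integration.integral_nonneg) auto
  also have "\<dots> = (\<integral>(x, y). T x y \<partial>(?S \<Otimes>\<^sub>M ?S))"
    using SS.integral_snd[OF intT] by simp
  also have "\<dots> = (1 / (real N)\<^sup>2) * (\<Sum>i=1..N. \<Sum>j=1..N. (overlap (z i) (z j))\<^sup>2)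
      - (2 / real N) * (\<Sum>i=1..N. C) + C"
    using pp pa aa by (simp add: T_def Epp Epa Eaa)
  \<comment> \<open>The cross terms add up to \<open>- 2 * C\<close>, so with the last term
    \<open>- C\<close> remains.\<close>
  also have "\<dots> = (1 / (real N)\<^sup>2) * (\<Sum>i=1..N. \<Sum>j=1..N. (overlap (z i) (z j))\<^sup>2) - C"
    using assms(3) by simp
  finally have D: "4 * (slice_discrepancy N z)\<^sup>2 =
      (1 / (real N)\<^sup>2) * (\<Sum>i=1..N. \<Sum>j=1..N. 4 * (overlap (z i) (z j))\<^sup>2) - 4 * C"
    unfolding sum_distrib_left[symmetric] by simp
  have sq: "4 * (overlap v w)\<^sup>2 = (1 - geodesic_dist v w)\<^sup>2" if "norm v = 1" "norm w = 1" for v w :: 'a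
    by (simp add: overlap_eq_geodesic_dist that power_divide)
  have "(LINT y|?S. LINT x|?S. (1 - geodesic_dist x y)\<^sup>2) = (LINT y|?S. LINT x|?S. 4 * (overlap y x)\<^sup>2)"
    by (intro Bochner_Integration.integral_cong) (auto simp: sq geodesic_dist_def inner_commute)
  \<comment> \<open>The inner integral over \<open>x\<close> has the same value for every
    \<open>y\<close> on the sphere.\<close>
  also have "\<dots> = (LINT y|?S. 4 * C)"
    by (intro Bochner_Integration.integral_cong) (auto simp: C)
  also have "\<dots> = 4 * C"
    by simp
  finally show ?thesis
    unfolding D by (simp add: sq z)
qed

end
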